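(* Let $\mathbb{F}$ be a finite field, let $\lambda\in\mathbb{F}^\times$, and let $L_\lambda$ be multiplication by $\lambda$ on $\mathbb{F}$. Then there exists a doubly transitive quandle homomorphism having a fiber isomorphic to the Alexander quandle $\mathrm{Alex}((\mathbb{F},+),L_\lambda)$. Consequently, both trivial fibers and non-trivial connected Alexander fibers occur as fibers of doubly transitive homomorphisms.
   Context: A quandle is a set $Q$ with bijections $s_x\colon Q\to Q$ ($x\in Q$) such that $s_x(x)=x$ and $s_x\circ s_y=s_{s_x(y)}\circ s_x$ for all $x,y\in Q$. A quandle homomorphism $f\colon P\to Q$ is a map with $f(s_x(y))=s_{f(x)}(f(y))$ for all $x,y\in P$. The inner automorphism group $\mathrm{Inn}(P)$ is the group of permutations of $P$ generated by all $s_x$, $x\in P$. A surjective quandle homomorphism $f\colon P\to Q$ induces a surjective group homomorphism $f_*\colon\mathrm{Inn}(P)\to\mathrm{Inn}(Q)$, where $f_*(\varphi)$ is the unique element of $\mathrm{Inn}(Q)$ with $f\circ\varphi=f_*(\varphi)\circ f$. Put $\mathrm{Inn}_{\mathrm{rel}}(f)=\ker(f_* )$; it preserves each fiber of $f$. The homomorphism $f$ is doubly transitive if it is surjective and for each $q\in Q$ the action of $\mathrm{Inn}_{\mathrm{rel}}(f)$ on $f^{-1}(q)$ is $2$-transitive. Fibers are regarded as subquandles of $P$. A quandle is trivial if $s_x=\mathrm{id}$ for all $x$. A quandle $F$ is connected if it is non-empty and $\mathrm{Inn}(F)$ acts transitively on $F$. For an abelian group $A$ and $\sigma\in\mathrm{Aut}(A)$,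 $\mathrm{Alex}(A,\sigma)$ is the set $A$ with $s_x(y)=x+\sigma(y-x)$; so $\mathrm{Alex}((\mathbb{F},+),L_\lambda)$ has $s_x(y)=(1-\lambda)x+\lambda y$. *)

theory Defs
  imports "HOL-Algebra.Algebra"
begin

record 'a quandle = "'a partial_object" +
  sym :: "'a \<Rightarrow> 'a \<Rightarrow> 'a"

locale quandle =
  fixes Q :: "('a, 'm) quandle_scheme"
  assumes bij: "x \<in> carrier Q \<Longrightarrow> bij_betw (sym Q x) (carrier Q) (carrier Q)"
    and idem: "x \<in> carrier Q \<Longrightarrow> sym Q x x = x"
    and distrib: "\<lbrakk>x \<in> carrier Q; y \<in> carrier Q; z \<in> carrier Q\<rbrakk>
      \<Longrightarrow> sym Q x (sym Q y z) = sym Q (sym Q x y) (sym Q x z)"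

definition quandle_hom ::
    "('a, 'm) quandle_scheme \<Rightarrow> ('b, 'n) quandle_scheme \<Rightarrow> ('a \<Rightarrow> 'b) set" where
  "quandle_hom P Q = {f \<in> carrier P \<rightarrow> carrier Q.
     \<forall>x \<in> carrier P. \<forall>y \<in> carrier P. f (sym P x y) = sym Q (f x) (f y)}"

definition quandle_isomorphic ::
    "('a, 'm) quandle_scheme \<Rightarrow> ('b, 'n) quandle_scheme \<Rightarrow> bool" where
  "quandle_isomorphic P Q \<longleftrightarrow> (\<exists>h \<in> quandle_hom P Q. bij_betw h (carrier P) (carrier Q))"

text \<open>
  Elements of \<^const>\<open>BijGroup\<close> are extensional, so each map \<open>sym P x\<close> has to be restricted to the
  carrier. For the same reason an element of \<open>Inn Q\<close> is determined by its values on the carrier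
  of \<open>Q\<close>, so that the description in \<open>Inn_map\<close> below is unique for surjective \<open>f\<close>.
\<close>

definition Inn :: "('a, 'm) quandle_scheme \<Rightarrow> ('a \<Rightarrow> 'a) monoid" where
  "Inn P = subgroup_generated (BijGroup (carrier P))
     ((\<lambda>x. restrict (sym P x) (carrier P)) ` carrier P)"

definition Inn_map ::
    "('a, 'm) quandle_scheme \<Rightarrow> ('b, 'n) quandle_scheme \<Rightarrow> ('a \<Rightarrow> 'b) \<Rightarrow> ('a \<Rightarrow> 'a) \<Rightarrow> ('b \<Rightarrow> 'b)" where
  "Inn_map P Q f \<phi> =
     (THE \<psi>. \<psi> \<in> carrier (Inn Q) \<and> (\<forall>x \<in> carrier P. f (\<phi> x) = \<psi> (f x)))"

definition Inn_rel ::
    "('a, 'm) quandle_scheme \<Rightarrow> ('b, 'n) quandle_scheme \<Rightarrow> ('a \<Rightarrow> 'b) \<Rightarrow> ('a \<Rightarrow> 'a) set" where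
  "Inn_rel P Q f = kernel (Inn P) (Inn Q) (Inn_map P Q f)"

definition fiber :: "('a, 'm) quandle_scheme \<Rightarrow> ('a \<Rightarrow> 'b) \<Rightarrow> 'b \<Rightarrow> ('a, 'm) quandle_scheme" where
  "fiber P f q = P\<lparr>carrier := {x \<in> carrier P. f x = q}\<rparr>"

text \<open>Transitivity on ordered pairs of distinct points; singletons are not excluded.\<close>

definition two_transitive_on :: "('a \<Rightarrow> 'a) set \<Rightarrow> 'a set \<Rightarrow> bool" where
  "two_transitive_on G S \<longleftrightarrow>
     (\<forall>x \<in> S. \<forall>y \<in> S. \<forall>u \<in> S. \<forall>v \<in> S. x \<noteq> y \<longrightarrow> u \<noteq> v \<longrightarrow> (\<exists>g \<in> G. g x = u \<and> g y = v))"

definition doubly_transitive ::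
    "('a, 'm) quandle_scheme \<Rightarrow> ('b, 'n) quandle_scheme \<Rightarrow> ('a \<Rightarrow> 'b) \<Rightarrow> bool" where
  "doubly_transitive P Q f \<longleftrightarrow>
     quandle P \<and> quandle Q \<and> f \<in> quandle_hom P Q \<and> f ` carrier P = carrier Q \<and>
     (\<forall>q \<in> carrier Q. two_transitive_on (Inn_rel P Q f) (carrier (fiber P f q)))"

definition trivial_quandle :: "('a, 'm) quandle_scheme \<Rightarrow> bool" where
  "trivial_quandle Q \<longleftrightarrow> (\<forall>x \<in> carrier Q. \<forall>y \<in> carrier Q. sym Q x y = y)"

definition connected_quandle :: "('a, 'm) quandle_scheme \<Rightarrow> bool" where
  "connected_quandle Q \<longleftrightarrow> carrier Q \<noteq> {} \<and>
     (\<forall>x \<in> carrier Q. \<forall>y \<in> carrier Q. \<exists>\<phi> \<in> carrier (Inn Q). \<phi> x = y)"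

text \<open>The abelian group \<open>A\<close> is written multiplicatively: \<open>sym x y\<close> is \<open>x + \<sigma> (y - x)\<close>.\<close>

definition Alex :: "('a, 'm) monoid_scheme \<Rightarrow> ('a \<Rightarrow> 'a) \<Rightarrow> 'a quandle" where
  "Alex A \<sigma> = \<lparr>carrier = carrier A,
     sym = (\<lambda>x y. x \<otimes>\<^bsub>A\<^esub> \<sigma> (y \<otimes>\<^bsub>A\<^esub> inv\<^bsub>A\<^esub> x))\<rparr>"

end

theory Submission
  imports Defs "HOL-Library.Countable_Set"
begin

text \<open>
  Let \<open>P\<close> be the set of all pairs \<open>(\<mu>, c)\<close> with \<open>\<mu> \<in> F\<^sup>\<times>\<close> and \<open>c \<in> F\<close>, where \<open>(\<mu>, c)\<close> acts on the second
  component of every pair as the homothety with ratio \<open>\<mu>\<close> and centre \<open>c\<close>. An affine map conjugates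
  this homothety to the one with ratio \<open>\<mu>\<close> and centre the image of \<open>c\<close>, so \<open>P\<close> is a quandle. Its
  projection \<open>(\<mu>, c) \<mapsto> \<mu>\<close> is a homomorphism to a trivial quandle, whence the relative inner group
  is all of \<open>Inn P\<close>, and the fiber over \<open>\<lambda>\<close> is the Alexander quandle with parameter \<open>\<lambda>\<close>. If \<open>F\<close> has
  more than two elements, products of two homotheties exhaust the affine group of the line, which
  is 2-transitive. Over the field with two elements all homotheties are trivial; there one takes two
  trivial fibers of size two, each point acting as the swap on the opposite fiber.
\<close>

section \<open>Inner automorphisms and quandle isomorphisms\<close>

lemma (in quandle) sym_closed:
  "x \<in> carrier Q \<Longrightarrow> y \<in> carrier Q \<Longrightarrow> sym Q x y \<in> carrier Q"
  using bij bij_betwE by blast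

lemma (in quandle) restrict_sym_in_Inn:
  assumes "x \<in> carrier Q"
  shows "restrict (sym Q x) (carrier Q) \<in> carrier (Inn Q)"
proof -
  have "restrict (sym Q x) (carrier Q) \<in> carrier (BijGroup (carrier Q))"
    using bij[OF assms] by (auto simp: BijGroup_def Bij_def cong: bij_betw_cong)
  then show ?thesis
    using assms unfolding Inn_def carrier_subgroup_generated
    by (intro generate.incl) auto
qed

text \<open>Makes inner automorphisms extensional bijections, so that their product is
  \<open>compose\<close> and their values on the carrier determine them.\<close>

lemma (in quandle) carrier_Inn_subset_Bij: "carrier (Inn Q) \<subseteq> Bij (carrier Q)"
  using group.carrier_subgroup_generated_subset[OF group_BijGroup]
  by (auto simp: Inn_def BijGroup_def)

lemma one_Inn: "\<one>\<^bsub>Inn Q\<^esub> = restrict (\<lambda>x. x) (carrier Q)"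
  by (simp add: Inn_def BijGroup_def)

lemma group_Inn: "group (Inn Q)"
  unfolding Inn_def by (intro group.group_subgroup_generated group_BijGroup)

lemma (in quandle) compose_in_Inn:
  assumes "g \<in> carrier (Inn Q)" "h \<in> carrier (Inn Q)"
  shows "compose (carrier Q) g h \<in> carrier (Inn Q)"
proof -
  have "g \<otimes>\<^bsub>Inn Q\<^esub> h = compose (carrier Q) g h"
    using carrier_Inn_subset_Bij assms by (auto simp: Inn_def BijGroup_def)
  then show ?thesis
    using group_Inn[of Q] assms by (metis group.is_monoid monoid.m_closed)
qed

text \<open>Idempotence of \<open>q\<close> makes the fiber over \<open>q\<close> stable under the
  symmetries of its points. Since the fiber may be infinite, surjectivity is a separate point; it
  comes from injectivity of \<open>sym Q q\<close>.\<close>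

lemma quandle_hom_fiber:
  assumes "f \<in> quandle_hom P Q" "quandle P" "quandle Q" "q \<in> carrier Q"
  shows "quandle (fiber P f q)"
proof -
  interpret P: quandle P by fact
  interpret Q: quandle Q by fact
  have f: "f (sym P x y) = sym Q (f x) (f y)" if "x \<in> carrier P" "y \<in> carrier P" for x y
    using assms(1) that by (auto simp: quandle_hom_def)
  have fc: "f x \<in> carrier Q" if "x \<in> carrier P" for x
    using assms(1) that by (auto simp: quandle_hom_def)
  show ?thesis
  proof
    fix x assume "x \<in> carrier (fiber P f q)"
    then have x: "x \<in> carrier P" "f x = q" by (auto simp: fiber_def)
    have "inj_on (sym P x) {y \<in> carrier P. f y = q}"
      using P.bij[OF x(1)] by (auto simp: bij_betw_def inj_on_def)
    moreover have "sym P x ` {y \<in> carrier P. f y = q} = {y \<in> carrier P. f y = q}"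
    proof
      show "sym P x ` {y \<in> carrier P. f y = q} \<subseteq> {y \<in> carrier P. f y = q}"
        using x f P.sym_closed Q.idem assms(4) by auto
      show "{y \<in> carrier P. f y = q} \<subseteq> sym P x ` {y \<in> carrier P. f y = q}"
      proof
        fix y assume y: "y \<in> {y \<in> carrier P. f y = q}"
        then obtain z where z: "z \<in> carrier P" "y = sym P x z"
          using P.bij[OF x(1)] by (auto simp: bij_betw_def)
        \<comment> \<open>Both sides equal \<open>q\<close>: the left one is \<open>f y\<close>, the
          right one is idempotence.\<close>
        then have "sym Q q (f z) = sym Q q q"
          using f x y Q.idem assms(4) by auto
        then have "f z = q"
          using Q.bij[OF assms(4)] fc[OF z(1)] assms(4) by (auto simp: bij_betw_def inj_on_def)
        then show "y \<in> sym P x ` {y \<in> carrier P. f y = q}"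
          using z by auto
      qed
    qed
    ultimately show "bij_betw (sym (fiber P f q) x) (carrier (fiber P f q)) (carrier (fiber P f q))"
      by (simp add: fiber_def bij_betw_def)
  qed (auto simp: fiber_def P.idem P.distrib)
qed

lemma quandle_isomorphic_trans:
  assumes "quandle_isomorphic P Q" "quandle_isomorphic Q R"
  shows "quandle_isomorphic P R"
proof -
  obtain g h where g: "g \<in> quandle_hom P Q" "bij_betw g (carrier P) (carrier Q)"
    and h: "h \<in> quandle_hom Q R" "bij_betw h (carrier Q) (carrier R)"
    using assms by (auto simp: quandle_isomorphic_def)
  have "h \<circ> g \<in> quandle_hom P R"
    using g(1) h(1) by (auto simp: quandle_hom_def Pi_iff)
  then show ?thesis
    using bij_betw_trans[OF g(2) h(2)] by (auto simp: quandle_isomorphic_def)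
qed

lemma quandle_isomorphic_trivial_iff:
  assumes "quandle_isomorphic P Q" "quandle P"
  shows "trivial_quandle P \<longleftrightarrow> trivial_quandle Q"
proof -
  interpret P: quandle P by fact
  obtain h where h: "\<And>x y. x \<in> carrier P \<Longrightarrow> y \<in> carrier P \<Longrightarrow> h (sym P x y) = sym Q (h x) (h y)"
    and inj: "inj_on h (carrier P)" and im: "h ` carrier P = carrier Q"
    using assms(1) by (auto simp: quandle_isomorphic_def quandle_hom_def bij_betw_def)
  have "sym P x y = y \<longleftrightarrow> sym Q (h x) (h y) = h y" if "x \<in> carrier P" "y \<in> carrier P" for x y
    using inj that P.sym_closed h by (metis inj_on_eq_iff)
  then show ?thesis
    unfolding trivial_quandle_def im[symmetric] by simp
qed

lemma quandle_isomorphic_card: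
  "quandle_isomorphic P Q \<Longrightarrow> card (carrier P) = card (carrier Q)"
  by (auto simp: quandle_isomorphic_def intro: bij_betw_same_card)

lemma (in quandle) connected_quandleI:
  assumes "carrier Q \<noteq> {}"
    and "\<And>x y. x \<in> carrier Q \<Longrightarrow> y \<in> carrier Q \<Longrightarrow> \<exists>p\<in>carrier Q. sym Q p x = y"
  shows "connected_quandle Q"
  unfolding connected_quandle_def
proof (intro conjI ballI)
  fix x y assume xy: "x \<in> carrier Q" "y \<in> carrier Q"
  then obtain p where "p \<in> carrier Q" "sym Q p x = y" using assms(2) by blast
  then show "\<exists>\<phi>\<in>carrier (Inn Q). \<phi> x = y"
    using restrict_sym_in_Inn[of p] xy by (intro bexI[of _ "restrict (sym Q p) (carrier Q)"]) auto
qed (fact assms(1))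

text \<open>If single symmetries already act transitively on \<open>Q\<close>, they can be pulled
  back along the isomorphism one at a time, without transporting the group
  \<open>Inn Q\<close>.\<close>

lemma quandle_isomorphic_connectedI:
  assumes "quandle_isomorphic P Q" "quandle P" "carrier Q \<noteq> {}"
    and "\<And>x y. x \<in> carrier Q \<Longrightarrow> y \<in> carrier Q \<Longrightarrow> \<exists>p\<in>carrier Q. sym Q p x = y"
  shows "connected_quandle P"
proof -
  interpret P: quandle P by fact
  obtain h where h: "\<And>x y. x \<in> carrier P \<Longrightarrow> y \<in> carrier P \<Longrightarrow> h (sym P x y) = sym Q (h x) (h y)"
    and inj: "inj_on h (carrier P)" and im: "h ` carrier P = carrier Q"
    using assms(1) by (auto simp: quandle_isomorphic_def quandle_hom_def bij_betw_def)
  show ?thesis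
  proof (rule P.connected_quandleI)
    show "carrier P \<noteq> {}" using im assms(3) by auto
    fix x y assume xy: "x \<in> carrier P" "y \<in> carrier P"
    then have "h x \<in> carrier Q" "h y \<in> carrier Q" using im by auto
    then obtain p where p: "p \<in> carrier P" "sym Q (h p) (h x) = h y"
      using assms(4)[of "h x" "h y"] im by (metis imageE)
    then have "sym P p x = y"
      using inj xy h P.sym_closed by (metis inj_onD)
    then show "\<exists>p\<in>carrier P. sym P p x = y" using p by blast
  qed
qed

section \<open>Homomorphisms to trivial quandles\<close>

lemma quandle_trivial: "quandle \<lparr>carrier = A, sym = (\<lambda>x y. y)\<rparr>"
  by unfold_locales (auto simp: bij_betw_def)

text \<open>The first hypothesis says that \<open>f\<close> is a homomorphism to a trivial quandle.
  Each product of two symmetries then preserves \<open>f\<close>, so it induces the identity on the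
  base and lies in the relative inner group.\<close>

lemma (in quandle) doubly_transitive_over_trivial:
  fixes f :: "'a \<Rightarrow> 'c"
  assumes inv: "\<And>x y. x \<in> carrier Q \<Longrightarrow> y \<in> carrier Q \<Longrightarrow> f (sym Q x y) = f y"
    and two: "\<And>x y u v. \<lbrakk>x \<in> carrier Q; y \<in> carrier Q; u \<in> carrier Q; v \<in> carrier Q;
        f y = f x; f u = f x; f v = f x; x \<noteq> y; u \<noteq> v\<rbrakk>
      \<Longrightarrow> \<exists>p\<in>carrier Q. \<exists>r\<in>carrier Q. sym Q p (sym Q r x) = u \<and> sym Q p (sym Q r y) = v"
  shows "doubly_transitive Q \<lparr>carrier = f ` carrier Q, sym = (\<lambda>x y. y)\<rparr> f"
proof -
  define T :: "'c quandle" where "T = \<lparr>carrier = f ` carrier Q, sym = (\<lambda>x y. y)\<rparr>"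
  have T: "quandle T" unfolding T_def by (rule quandle_trivial)
  have rel: "g \<in> Inn_rel Q T f"
    if g: "g \<in> carrier (Inn Q)" "\<And>x. x \<in> carrier Q \<Longrightarrow> f (g x) = f x" for g
  proof -
    have one: "\<one>\<^bsub>Inn T\<^esub> \<in> carrier (Inn T)"
      using group_Inn[of T] by (metis group.is_monoid monoid.one_closed)
    have "Inn_map Q T f g = \<one>\<^bsub>Inn T\<^esub>"
      unfolding Inn_map_def
    proof (rule the_equality)
      show "\<one>\<^bsub>Inn T\<^esub> \<in> carrier (Inn T) \<and> (\<forall>x\<in>carrier Q. f (g x) = \<one>\<^bsub>Inn T\<^esub> (f x))"
        using one g(2) by (simp add: one_Inn T_def)
      fix \<psi> assume \<psi>: "\<psi> \<in> carrier (Inn T) \<and> (\<forall>x\<in>carrier Q. f (g x) = \<psi> (f x))"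
      \<comment> \<open>On the carrier of \<open>T\<close>, which is the image of \<open>f\<close>,
        the values of \<open>\<psi>\<close> are forced; extensionality fixes the rest and gives the
        uniqueness that \<open>THE\<close> demands.\<close>
      then have "\<psi> \<in> extensional (carrier T)"
        using quandle.carrier_Inn_subset_Bij[OF T] by (auto simp: Bij_def)
      then show "\<psi> = \<one>\<^bsub>Inn T\<^esub>"
        unfolding one_Inn
        by (rule extensionalityI[OF _ restrict_extensional]) (use \<psi> g(2) in \<open>auto simp: T_def\<close>)
    qed
    then show ?thesis using g(1) by (simp add: Inn_rel_def kernel_def)
  qed
  have "two_transitive_on (Inn_rel Q T f) (carrier (fiber Q f q))" for q
    unfolding two_transitive_on_def
  proof (intro ballI impI)
    fix x y u v
    assume A: "x \<in> carrier (fiber Q f q)" "y \<in> carrier (fiber Q f q)"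
      "u \<in> carrier (fiber Q f q)" "v \<in> carrier (fiber Q f q)" "x \<noteq> y" "u \<noteq> v"
    then have xy: "x \<in> carrier Q" "y \<in> carrier Q" by (auto simp: fiber_def)
    obtain p r where pr: "p \<in> carrier Q" "r \<in> carrier Q"
      "sym Q p (sym Q r x) = u" "sym Q p (sym Q r y) = v"
      using two[of x y u v] A by (auto simp: fiber_def)
    define g where
      "g = compose (carrier Q) (restrict (sym Q p) (carrier Q)) (restrict (sym Q r) (carrier Q))"
    have gx: "g z = sym Q p (sym Q r z)" if "z \<in> carrier Q" for z
      using that pr sym_closed by (simp add: g_def compose_def)
    have "g \<in> carrier (Inn Q)"
      unfolding g_def using pr by (intro compose_in_Inn restrict_sym_in_Inn)
    moreover have "f (g z) = f z" if "z \<in> carrier Q" for z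
      using that pr sym_closed inv gx by simp
    ultimately show "\<exists>g\<in>Inn_rel Q T f. g x = u \<and> g y = v"
      using rel gx pr xy by blast
  qed
  moreover have "f \<in> quandle_hom Q T"
    using inv by (auto simp: quandle_hom_def T_def)
  ultimately show ?thesis
    unfolding doubly_transitive_def T_def[symmetric]
    using T quandle_axioms by (auto simp: T_def)
qed

text \<open>An existence statement has to fix the element types. Countable carriers are coded by
  naturals: \<open>e\<close> and \<open>d\<close> code and decode points of the quandle,
  \<open>i\<close> codes points of the base.\<close>

lemma (in quandle) doubly_transitive_nat_copy:
  fixes f :: "'a \<Rightarrow> 'c"
  assumes cnt: "countable (carrier Q)"
    and inv: "\<And>x y. x \<in> carrier Q \<Longrightarrow> y \<in> carrier Q \<Longrightarrow> f (sym Q x y) = f y"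
    and two: "\<And>x y u v. \<lbrakk>x \<in> carrier Q; y \<in> carrier Q; u \<in> carrier Q; v \<in> carrier Q;
        f y = f x; f u = f x; f v = f x; x \<noteq> y; u \<noteq> v\<rbrakk>
      \<Longrightarrow> \<exists>p\<in>carrier Q. \<exists>r\<in>carrier Q. sym Q p (sym Q r x) = u \<and> sym Q p (sym Q r y) = v"
    and t: "t \<in> f ` carrier Q"
  shows "\<exists>(P' :: nat quandle) (Q' :: nat quandle) f' q. doubly_transitive P' Q' f' \<and>
           q \<in> carrier Q' \<and> quandle_isomorphic (fiber P' f' q) (fiber Q f t)"
proof -
  define e where "e = to_nat_on (carrier Q)"
  define d where "d = from_nat_into (carrier Q)"
  define i where "i = to_nat_on (f ` carrier Q)"
  have de[simp]: "d (e x) = x" if "x \<in> carrier Q" for x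
    using that cnt by (simp add: d_def e_def)
  have i_eq: "i a = i b \<longleftrightarrow> a = b" if "a \<in> f ` carrier Q" "b \<in> f ` carrier Q" for a b
    using that cnt by (simp add: i_def)
  define P where "P = \<lparr>carrier = e ` carrier Q, sym = (\<lambda>x y. e (sym Q (d x) (d y)))\<rparr>"
  define g where "g = (\<lambda>n. i (f (d n)))"
  have "quandle P"
  proof
    fix x assume "x \<in> carrier P"
    then obtain x' where x': "x' \<in> carrier Q" "x = e x'" by (auto simp: P_def)
    have "bij_betw d (e ` carrier Q) (carrier Q)" "bij_betw e (carrier Q) (e ` carrier Q)"
      by (intro bij_betw_byWitness[where f' = e] bij_betw_byWitness[where f' = d]; auto)+
    then have "bij_betw (e \<circ> (sym Q x' \<circ> d)) (e ` carrier Q) (e ` carrier Q)"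
      using bij[OF x'(1)] by (meson bij_betw_trans)
    then show "bij_betw (sym P x) (carrier P) (carrier P)"
      using x' by (simp add: P_def comp_def)
  next
    fix x y z assume "x \<in> carrier P" "y \<in> carrier P" "z \<in> carrier P"
    then show "sym P x (sym P y z) = sym P (sym P x y) (sym P x z)"
      by (auto simp: P_def sym_closed intro!: arg_cong[where f = e] distrib)
  qed (auto simp: P_def idem)
  then interpret P: quandle P .
  have "doubly_transitive P \<lparr>carrier = g ` carrier P, sym = (\<lambda>x y. y)\<rparr> g"
  proof (rule P.doubly_transitive_over_trivial)
    show "g (sym P x y) = g y" if "x \<in> carrier P" "y \<in> carrier P" for x y
      using that by (auto simp: P_def g_def sym_closed inv)
    fix x y u v
    assume A: "x \<in> carrier P" "y \<in> carrier P" "u \<in> carrier P" "v \<in> carrier P"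
      "g y = g x" "g u = g x" "g v = g x" "x \<noteq> y" "u \<noteq> v"
    then obtain x' y' u' v' where B: "x' \<in> carrier Q" "y' \<in> carrier Q" "u' \<in> carrier Q"
      "v' \<in> carrier Q" "x = e x'" "y = e y'" "u = e u'" "v = e v'"
      by (auto simp: P_def)
    have "\<exists>p\<in>carrier Q. \<exists>r\<in>carrier Q. sym Q p (sym Q r x') = u' \<and> sym Q p (sym Q r y') = v'"
      using A B by (intro two) (auto simp: g_def i_eq)
    then obtain p r where "p \<in> carrier Q" "r \<in> carrier Q"
      "sym Q p (sym Q r x') = u'" "sym Q p (sym Q r y') = v'" by blast
    then show "\<exists>p\<in>carrier P. \<exists>r\<in>carrier P. sym P p (sym P r x) = u \<and> sym P p (sym P r y) = v"
      using B by (intro bexI[of _ "e p"] bexI[of _ "e r"]) (auto simp: P_def sym_closed)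
  qed
  moreover have "i t \<in> g ` carrier P"
    using t unfolding g_def P_def by (auto simp: image_image)
  \<comment> \<open>Because \<open>i\<close> is injective on the base, decoding matches the fiber
    over \<open>i t\<close> with the fiber over \<open>t\<close>.\<close>
  moreover have "quandle_isomorphic (fiber P g (i t)) (fiber Q f t)"
    unfolding quandle_isomorphic_def
  proof (intro bexI[of _ d])
    show "bij_betw d (carrier (fiber P g (i t))) (carrier (fiber Q f t))"
      by (rule bij_betw_byWitness[where f' = e])
        (use t in \<open>auto simp: fiber_def P_def g_def i_eq\<close>)
    show "d \<in> quandle_hom (fiber P g (i t)) (fiber Q f t)"
      using t by (auto simp: quandle_hom_def fiber_def P_def g_def i_eq sym_closed)
  qed
  ultimately show ?thesis
    by (intro exI[of _ P] exI[of _ "\<lparr>carrier = g ` carrier P, sym = (\<lambda>x y. y)\<rparr>"]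
        exI[of _ g] exI[of _ "i t"]) simp
qed

section \<open>The quandle of homotheties of a field\<close>

context field
begin

text \<open>For fixed ratio this is the Alexander operation. Keeping the ratio as an argument lets
  different ratios act on the same line.\<close>

definition homothety :: "'a \<Rightarrow> 'a \<Rightarrow> 'a \<Rightarrow> 'a" where
  "homothety \<mu> c y = c \<oplus> \<mu> \<otimes> (y \<ominus> c)"

lemma sym_Alex_add_monoid:
  "sym (Alex (add_monoid R) (\<lambda>y. l \<otimes> y)) = homothety l"
  by (simp add: Alex_def homothety_def a_minus_def a_inv_def fun_eq_iff)

lemma homothety_closed [simp]:
  "\<lbrakk>\<mu> \<in> carrier R; c \<in> carrier R; y \<in> carrier R\<rbrakk> \<Longrightarrow> homothety \<mu> c y \<in> carrier R"
  by (simp add: homothety_def)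

lemma homothety_centre: "\<lbrakk>\<mu> \<in> carrier R; c \<in> carrier R\<rbrakk> \<Longrightarrow> homothety \<mu> c c = c"
  unfolding homothety_def by algebra

lemma homothety_one: "\<lbrakk>c \<in> carrier R; y \<in> carrier R\<rbrakk> \<Longrightarrow> homothety \<one> c y = y"
  unfolding homothety_def by algebra

lemma homothety_homothety:
  assumes "\<mu> \<in> carrier R" "\<nu> \<in> carrier R" "c \<in> carrier R" "y \<in> carrier R"
  shows "homothety \<mu> c (homothety \<nu> c y) = homothety (\<mu> \<otimes> \<nu>) c y"
  using assms unfolding homothety_def by algebra

text \<open>Conjugating a homothety by an affine map moves its centre and keeps its ratio. Allowing
  two different ratios is what lets the fibers act on each other.\<close>

lemma homothety_distrib:
  assumes "\<mu> \<in> carrier R" "\<nu> \<in> carrier R" "a \<in> carrier R" "b \<in> carrier R" "y \<in> carrier R"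
  shows "homothety \<mu> a (homothety \<nu> b y) = homothety \<nu> (homothety \<mu> a b) (homothety \<mu> a y)"
  using assms unfolding homothety_def by algebra

text \<open>Separates slope from constant term: once the ratios are chosen with
  \<open>\<beta> \<noteq> \<one>\<close>, the centre \<open>c\<close> can still realise any constant
  term.\<close>

lemma homothety_affine:
  assumes "\<beta> \<in> carrier R" "\<rho> \<in> carrier R" "c \<in> carrier R" "y \<in> carrier R"
  shows "homothety \<beta> c (homothety \<rho> \<zero> y) = (\<one> \<ominus> \<beta>) \<otimes> c \<oplus> (\<beta> \<otimes> \<rho>) \<otimes> y"
  using assms unfolding homothety_def by algebra

lemma mem_Units_iff: "\<mu> \<in> Units R \<longleftrightarrow> \<mu> \<in> carrier R \<and> \<mu> \<noteq> \<zero>"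
  by (auto simp: field_Units)

text \<open>The affine map taking \<open>x\<close> to \<open>u\<close> and \<open>y\<close> to
  \<open>v\<close> has slope \<open>\<alpha>\<close>, the quotient of \<open>u \<ominus> v\<close>
  by \<open>x \<ominus> y\<close>. It is factored through a homothety at \<open>\<zero>\<close> of
  ratio \<open>\<rho> \<noteq> \<alpha>\<close>; the remaining ratio differs from
  \<open>\<one>\<close>, so a suitable centre exists.\<close>

lemma homotheties_two_transitive:
  assumes c: "x \<in> carrier R" "y \<in> carrier R" "u \<in> carrier R" "v \<in> carrier R" "x \<noteq> y" "u \<noteq> v"
    and \<mu>: "\<mu> \<in> Units R" "\<mu> \<noteq> \<one>"
  shows "\<exists>\<beta>\<in>Units R. \<exists>c\<in>carrier R. \<exists>\<rho>\<in>Units R.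
           homothety \<beta> c (homothety \<rho> \<zero> x) = u \<and> homothety \<beta> c (homothety \<rho> \<zero> y) = v"
proof -
  have xy: "x \<ominus> y \<in> Units R" "u \<ominus> v \<in> Units R"
    using c by (auto simp: mem_Units_iff r_right_minus_eq)
  define \<alpha> where "\<alpha> = (u \<ominus> v) \<otimes> inv (x \<ominus> y)"
  have \<alpha>: "\<alpha> \<in> Units R" using xy by (simp add: \<alpha>_def)
  have \<alpha>xy: "\<alpha> \<otimes> (x \<ominus> y) = u \<ominus> v"
    using xy c by (simp add: \<alpha>_def m_assoc)
  \<comment> \<open>At least one of the two units \<open>\<one>\<close> and \<open>\<mu>\<close>
    differs from \<open>\<alpha>\<close>.\<close>
  obtain \<rho> where \<rho>: "\<rho> \<in> Units R" "\<rho> \<noteq> \<alpha>" using \<mu> by (metis Units_one_closed)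
  define \<beta> where "\<beta> = \<alpha> \<otimes> inv \<rho>"
  have \<beta>: "\<beta> \<in> Units R" using \<alpha> \<rho> by (simp add: \<beta>_def)
  have \<beta>\<rho>: "\<beta> \<otimes> \<rho> = \<alpha>" using \<alpha> \<rho> by (simp add: \<beta>_def m_assoc Units_closed)
  have "\<beta> \<noteq> \<one>" using \<beta>\<rho> \<rho> by (metis Units_closed l_one)
  then have \<beta>1: "\<one> \<ominus> \<beta> \<in> Units R"
    using \<beta> by (metis Units_closed mem_Units_iff minus_closed r_right_minus_eq one_closed)
  \<comment> \<open>The desired map sends \<open>z\<close> to
    \<open>u \<ominus> \<alpha> \<otimes> (x \<ominus> z)\<close>; its constant term
    \<open>u \<ominus> \<alpha> \<otimes> x\<close> must equal
    \<open>(\<one> \<ominus> \<beta>) \<otimes> c\<close>.\<close>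
  define c where "c = inv (\<one> \<ominus> \<beta>) \<otimes> (u \<ominus> \<alpha> \<otimes> x)"
  have cc: "c \<in> carrier R" using \<beta>1 \<alpha> c by (simp add: c_def Units_closed)
  have c_eq: "(\<one> \<ominus> \<beta>) \<otimes> c = u \<ominus> \<alpha> \<otimes> x"
    using \<beta>1 \<alpha> c by (simp add: c_def m_assoc[symmetric] Units_closed)
  have h: "homothety \<beta> c (homothety \<rho> \<zero> z) = u \<ominus> \<alpha> \<otimes> (x \<ominus> z)" if z: "z \<in> carrier R" for z
  proof -
    have "homothety \<beta> c (homothety \<rho> \<zero> z) = (u \<ominus> \<alpha> \<otimes> x) \<oplus> \<alpha> \<otimes> z"
      using z \<beta> \<rho> cc by (simp add: Units_closed homothety_affine c_eq \<beta>\<rho>)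
    also have "\<dots> = u \<ominus> \<alpha> \<otimes> (x \<ominus> z)"
      using z c Units_closed[OF \<alpha>] by algebra
    finally show ?thesis .
  qed
  have "u \<ominus> \<alpha> \<otimes> (x \<ominus> x) = u" using c Units_closed[OF \<alpha>] by algebra
  moreover have "u \<ominus> (u \<ominus> v) = v" using c by algebra
  ultimately show ?thesis
    using \<beta> \<rho> cc c by (intro bexI[of _ \<beta>] bexI[of _ c] bexI[of _ \<rho>]) (auto simp: h \<alpha>xy)
qed

text \<open>The acting point contributes its own ratio, while the moved point keeps its ratio. Thus
  the fiber of ratio \<open>\<one>\<close>, trivial in itself, is still moved by the other
  fibers.\<close>

definition homothety_quandle :: "('a \<times> 'a) quandle" where
  "homothety_quandle = \<lparr>carrier = Units R \<times> carrier R,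
     sym = (\<lambda>p q. (fst q, homothety (fst p) (snd p) (snd q)))\<rparr>"

lemma quandle_homothety_quandle: "quandle homothety_quandle"
proof
  fix p assume "p \<in> carrier homothety_quandle"
  then obtain \<mu> c where p: "p = (\<mu>, c)" "\<mu> \<in> Units R" "c \<in> carrier R"
    by (auto simp: homothety_quandle_def)
  show "bij_betw (sym homothety_quandle p) (carrier homothety_quandle) (carrier homothety_quandle)"
    by (rule bij_betw_byWitness[where f' = "\<lambda>q. (fst q, homothety (inv \<mu>) c (snd q))"])
      (use p in \<open>auto simp: homothety_quandle_def homothety_homothety homothety_one Units_closed\<close>)
qed (auto simp: homothety_quandle_def homothety_centre intro!: homothety_distrib)

lemma fiber_homothety_quandle:
  assumes "l \<in> Units R"
  shows "quandle_isomorphic (fiber homothety_quandle fst l) (Alex (add_monoid R) (\<lambda>y. l \<otimes> y))"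
  unfolding quandle_isomorphic_def
proof (intro bexI[of _ snd])
  show "bij_betw snd (carrier (fiber homothety_quandle fst l))
      (carrier (Alex (add_monoid R) (\<lambda>y. l \<otimes> y)))"
    by (rule bij_betw_byWitness[where f' = "\<lambda>y. (l, y)"])
      (use assms in \<open>auto simp: fiber_def homothety_quandle_def Alex_def\<close>)
  show "snd \<in> quandle_hom (fiber homothety_quandle fst l) (Alex (add_monoid R) (\<lambda>y. l \<otimes> y))"
    unfolding quandle_hom_def sym_Alex_add_monoid
    by (auto simp: fiber_def homothety_quandle_def Alex_def)
qed

section \<open>Triviality and transitivity of Alexander quandles over a field\<close>

lemma Alex_add_monoid_trivial: "trivial_quandle (Alex (add_monoid R) (\<lambda>y. \<one> \<otimes> y))"
  unfolding trivial_quandle_def sym_Alex_add_monoid by (simp add: Alex_def homothety_one)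

text \<open>The equation \<open>(\<one> \<ominus> l) \<otimes> p \<oplus> l \<otimes> x = y\<close>
  can be solved for \<open>p\<close>, since \<open>\<one> \<ominus> l\<close> is invertible.\<close>

lemma Alex_add_monoid_transitive:
  assumes l: "l \<in> carrier R" "l \<noteq> \<one>"
    and "x \<in> carrier (Alex (add_monoid R) (\<lambda>y. l \<otimes> y))"
    and "y \<in> carrier (Alex (add_monoid R) (\<lambda>y. l \<otimes> y))"
  shows "\<exists>p\<in>carrier (Alex (add_monoid R) (\<lambda>y. l \<otimes> y)).
           sym (Alex (add_monoid R) (\<lambda>y. l \<otimes> y)) p x = y"
proof -
  have xy: "x \<in> carrier R" "y \<in> carrier R" using assms(3,4) by (simp_all add: Alex_def)
  have u: "\<one> \<ominus> l \<in> Units R"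
    using l by (simp add: mem_Units_iff r_right_minus_eq)
  define p where "p = inv (\<one> \<ominus> l) \<otimes> (y \<ominus> l \<otimes> x)"
  have p: "p \<in> carrier R" using u l xy by (simp add: p_def)
  have "homothety l p x = (\<one> \<ominus> l) \<otimes> p \<oplus> l \<otimes> x"
    using p l xy unfolding homothety_def by algebra
  also have "(\<one> \<ominus> l) \<otimes> p = y \<ominus> l \<otimes> x"
    using u l xy by (simp add: p_def m_assoc[symmetric])
  also have "(y \<ominus> l \<otimes> x) \<oplus> l \<otimes> x = y"
    using l xy by algebra
  finally show ?thesis
    unfolding sym_Alex_add_monoid using p by (auto simp: Alex_def)
qed

text \<open>By transitivity some symmetry takes \<open>\<zero>\<close> to \<open>\<one>\<close>,
  whereas in a trivial quandle it would fix \<open>\<zero>\<close>.\<close>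

lemma Alex_add_monoid_not_trivial:
  assumes "l \<in> carrier R" "l \<noteq> \<one>"
  shows "\<not> trivial_quandle (Alex (add_monoid R) (\<lambda>y. l \<otimes> y))"
proof
  assume triv: "trivial_quandle (Alex (add_monoid R) (\<lambda>y. l \<otimes> y))"
  have mem: "\<zero> \<in> carrier (Alex (add_monoid R) (\<lambda>y. l \<otimes> y))"
    "\<one> \<in> carrier (Alex (add_monoid R) (\<lambda>y. l \<otimes> y))"
    by (simp_all add: Alex_def)
  show False
    using Alex_add_monoid_transitive[OF assms mem] triv mem(1)
    unfolding trivial_quandle_def by (metis zero_not_one)
qed

lemma mult_unit_iso_add_monoid:
  assumes "l \<in> Units R"
  shows "(\<lambda>y. l \<otimes> y) \<in> iso (add_monoid R) (add_monoid R)"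
proof -
  have "bij_betw (\<lambda>y. l \<otimes> y) (carrier R) (carrier R)"
    by (rule bij_betw_byWitness[where f' = "\<lambda>y. inv l \<otimes> y"])
      (use assms in \<open>auto simp: m_assoc[symmetric] Units_closed\<close>)
  then show ?thesis
    using assms by (auto simp: iso_def hom_def r_distr)
qed

end

section \<open>Two swapped pairs\<close>

text \<open>The first bit names the fiber, the second the point in it. Inequality of booleans is
  exclusive or, so the second bit flips exactly when the two points lie in different fibers.\<close>

definition swap_quandle :: "(bool \<times> bool) quandle" where
  "swap_quandle = \<lparr>carrier = UNIV, sym = (\<lambda>p q. (fst q, snd q \<noteq> (fst p \<noteq> fst q)))\<rparr>"

lemma quandle_swap_quandle: "quandle swap_quandle"
proof
  fix p
  show "bij_betw (sym swap_quandle p) (carrier swap_quandle) (carrier swap_quandle)"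
    by (rule bij_betw_byWitness[where f' = "sym swap_quandle p"]) (auto simp: swap_quandle_def)
qed (auto simp: swap_quandle_def)

lemma swap_quandle_two_transitive:
  assumes "fst y = fst x" "fst u = fst x" "fst v = fst x" "x \<noteq> y" "u \<noteq> v"
  shows "\<exists>p r. sym swap_quandle p (sym swap_quandle r x) = u \<and>
               sym swap_quandle p (sym swap_quandle r y) = v"
  using assms
  \<comment> \<open>The pairs \<open>x\<close>, \<open>y\<close> and \<open>u\<close>,
    \<open>v\<close> both exhaust the fiber, so only the identity or the swap is needed.
    \<open>r\<close> lies in the fiber of \<open>x\<close> and acts trivially on it;
    \<open>p\<close> lies in the opposite fiber exactly when \<open>x\<close> and \<open>u\<close>
    differ.\<close>
  by (intro exI[of _ "(fst x \<noteq> (snd x \<noteq> snd u), True)"] exI[of _ "(fst x, True)"])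
    (cases x; cases y; cases u; cases v; auto simp: swap_quandle_def)

section \<open>Realising Alexander fibers\<close>

text \<open>The homothety construction needs some ratio other than \<open>\<one>\<close>, not
  necessarily \<open>l\<close> itself; hence \<open>l = \<one>\<close> is covered by it too unless
  the field has two elements.\<close>

lemma (in field) Alex_fiber_exists:
  assumes fin: "finite (carrier R)" and l: "l \<in> Units R"
  shows "\<exists>(P :: nat quandle) (Q :: nat quandle) f q.
           doubly_transitive P Q f \<and> q \<in> carrier Q \<and>
           quandle_isomorphic (fiber P f q) (Alex (add_monoid R) (\<lambda>y. l \<otimes> y))"
proof (cases "\<exists>\<mu>\<in>Units R. \<mu> \<noteq> \<one>")
  case True
  then obtain \<mu> where \<mu>: "\<mu> \<in> Units R" "\<mu> \<noteq> \<one>" by blast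
  interpret H: quandle homothety_quandle by (rule quandle_homothety_quandle)
  have "\<exists>(P :: nat quandle) (Q :: nat quandle) f q. doubly_transitive P Q f \<and> q \<in> carrier Q \<and>
      quandle_isomorphic (fiber P f q) (fiber homothety_quandle fst l)"
  proof (rule H.doubly_transitive_nat_copy)
    have "Units R \<subseteq> carrier R" by (auto simp: mem_Units_iff)
    then have "finite (Units R)" using fin by (rule finite_subset)
    then show "countable (carrier homothety_quandle)"
      using fin by (simp add: homothety_quandle_def countable_finite)
    show "fst (sym homothety_quandle x y) = fst y" for x y
      by (simp add: homothety_quandle_def)
    show "l \<in> fst ` carrier homothety_quandle"
      using l zero_closed by (force simp: homothety_quandle_def)
    fix x y u v
    assume A: "x \<in> carrier homothety_quandle" "y \<in> carrier homothety_quandle"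
      "u \<in> carrier homothety_quandle" "v \<in> carrier homothety_quandle"
      "fst y = fst x" "fst u = fst x" "fst v = fst x" "x \<noteq> y" "u \<noteq> v"
    then have "snd x \<in> carrier R" "snd y \<in> carrier R" "snd u \<in> carrier R" "snd v \<in> carrier R"
      "snd x \<noteq> snd y" "snd u \<noteq> snd v"
      by (auto simp: prod_eq_iff homothety_quandle_def)
    from homotheties_two_transitive[OF this \<mu>] obtain \<beta> c \<rho> where "\<beta> \<in> Units R" "c \<in> carrier R" "\<rho> \<in> Units R"
      "homothety \<beta> c (homothety \<rho> \<zero> (snd x)) = snd u"
      "homothety \<beta> c (homothety \<rho> \<zero> (snd y)) = snd v" by blast
    with A show "\<exists>p\<in>carrier homothety_quandle. \<exists>r\<in>carrier homothety_quandle.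
        sym homothety_quandle p (sym homothety_quandle r x) = u \<and>
        sym homothety_quandle p (sym homothety_quandle r y) = v"
      by (intro bexI[of _ "(\<beta>, c)"] bexI[of _ "(\<rho>, \<zero>)"])
        (auto simp: homothety_quandle_def prod_eq_iff)
  qed
  then show ?thesis
    using quandle_isomorphic_trans[OF _ fiber_homothety_quandle[OF l]] by blast
next
  case False
  then have carr: "carrier R = {\<zero>, \<one>}" using mem_Units_iff by auto
  have l1: "l = \<one>" using False l by blast
  interpret S: quandle swap_quandle by (rule quandle_swap_quandle)
  have ex: "\<exists>(P :: nat quandle) (Q :: nat quandle) f q. doubly_transitive P Q f \<and> q \<in> carrier Q \<and>
      quandle_isomorphic (fiber P f q) (fiber swap_quandle fst True)"
  proof (rule S.doubly_transitive_nat_copy)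
    have "\<And>p. p \<in> carrier swap_quandle" by (simp add: swap_quandle_def)
    then show "\<exists>p\<in>carrier swap_quandle. \<exists>r\<in>carrier swap_quandle.
        sym swap_quandle p (sym swap_quandle r x) = u \<and>
        sym swap_quandle p (sym swap_quandle r y) = v"
      if "fst y = fst x" "fst u = fst x" "fst v = fst x" "x \<noteq> y" "u \<noteq> v" for x y u v
      using swap_quandle_two_transitive[OF that] by blast
  qed (auto simp: swap_quandle_def intro: countable_finite image_eqI[of _ _ "(True, True)"])
  have iso: "quandle_isomorphic (fiber swap_quandle fst True) (Alex (add_monoid R) (\<lambda>y. l \<otimes> y))"
    unfolding quandle_isomorphic_def
  \<comment> \<open>Both sides are trivial quandles with two points, so any bijection is an
    isomorphism.\<close>
  proof (intro bexI[of _ "\<lambda>p. if snd p then \<one> else \<zero>"])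
    show "bij_betw (\<lambda>p. if snd p then \<one> else \<zero>) (carrier (fiber swap_quandle fst True))
        (carrier (Alex (add_monoid R) (\<lambda>y. l \<otimes> y)))"
      by (rule bij_betw_byWitness[where f' = "\<lambda>y. (True, y = \<one>)"])
        (auto simp: fiber_def swap_quandle_def Alex_def carr)
    show "(\<lambda>p. if snd p then \<one> else \<zero>) \<in> quandle_hom (fiber swap_quandle fst True)
        (Alex (add_monoid R) (\<lambda>y. l \<otimes> y))"
      unfolding quandle_hom_def sym_Alex_add_monoid l1
      by (auto simp: fiber_def swap_quandle_def Alex_def homothety_one)
  qed
  show ?thesis using ex quandle_isomorphic_trans[OF _ iso] by blast
qed

section \<open>The field with three elements and the final statement\<close>

definition GF3 :: "nat ring" where
  "GF3 = \<lparr>carrier = {0, 1, 2}, monoid.mult = (\<lambda>x y. x * y mod 3), one = 1,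
     ring.zero = 0, ring.add = (\<lambda>x y. (x + y) mod 3)\<rparr>"

text \<open>Three is the smallest order of a field with a unit other than \<open>1\<close>, so this
  field provides both kinds of fibers.\<close>

lemma field_GF3: "field GF3"
proof -
  have "cring GF3"
  proof (intro cringI abelian_groupI comm_monoidI)
    show "\<exists>y\<in>carrier GF3. y \<oplus>\<^bsub>GF3\<^esub> x = \<zero>\<^bsub>GF3\<^esub>" if "x \<in> carrier GF3" for x
      using that by (auto simp: GF3_def)
  qed (auto simp: GF3_def)
  moreover have "Units GF3 = carrier GF3 - {\<zero>\<^bsub>GF3\<^esub>}"
    by (auto simp: GF3_def Units_def)
  ultimately show ?thesis by (rule cring.cring_fieldI)
qed

text \<open>The cardinality bound excludes empty and one-point fibers, on which triviality and
  2-transitivity hold automatically.\<close>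

theorem proposition0p7:
  shows "(\<forall>(F :: ('a, 'm) ring_scheme) l. field F \<and> finite (carrier F) \<and> l \<in> Units F \<longrightarrow>
        (\<exists>(P :: nat quandle) (Q :: nat quandle) f q.
           doubly_transitive P Q f \<and> q \<in> carrier Q \<and>
           quandle_isomorphic (fiber P f q) (Alex (add_monoid F) (\<lambda>y. l \<otimes>\<^bsub>F\<^esub> y))))
    \<and> (\<exists>(P :: nat quandle) (Q :: nat quandle) f q.
         doubly_transitive P Q f \<and> q \<in> carrier Q \<and>
         trivial_quandle (fiber P f q) \<and> 2 \<le> card (carrier (fiber P f q)))
    \<and> (\<exists>(P :: nat quandle) (Q :: nat quandle) f q (A :: nat monoid) \<sigma>.
         doubly_transitive P Q f \<and> q \<in> carrier Q \<and>
         comm_group A \<and> \<sigma> \<in> iso A A \<and> quandle_isomorphic (fiber P f q) (Alex A \<sigma>) \<and>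
         connected_quandle (fiber P f q) \<and> \<not> trivial_quandle (fiber P f q))"
proof (intro conjI allI impI)
  fix F :: "('a, 'm) ring_scheme" and l
  assume "field F \<and> finite (carrier F) \<and> l \<in> Units F"
  then show "\<exists>(P :: nat quandle) (Q :: nat quandle) f q.
      doubly_transitive P Q f \<and> q \<in> carrier Q \<and>
      quandle_isomorphic (fiber P f q) (Alex (add_monoid F) (\<lambda>y. l \<otimes>\<^bsub>F\<^esub> y))"
    by (intro field.Alex_fiber_exists) simp_all
next
  interpret K: field GF3 by (rule field_GF3)
  have fin: "finite (carrier GF3)" by (simp add: GF3_def)
  have fiber_quandle: "quandle (fiber P f q)"
    if "doubly_transitive P Q f" "q \<in> carrier Q" for P Q :: "nat quandle" and f q
    using that quandle_hom_fiber by (auto simp: doubly_transitive_def)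
  show "\<exists>(P :: nat quandle) (Q :: nat quandle) f q.
      doubly_transitive P Q f \<and> q \<in> carrier Q \<and>
      trivial_quandle (fiber P f q) \<and> 2 \<le> card (carrier (fiber P f q))"
  proof -
    obtain P Q :: "nat quandle" and f q where D: "doubly_transitive P Q f" "q \<in> carrier Q"
      and iso: "quandle_isomorphic (fiber P f q) (Alex (add_monoid GF3) (\<lambda>y. \<one>\<^bsub>GF3\<^esub> \<otimes>\<^bsub>GF3\<^esub> y))"
      using K.Alex_fiber_exists[OF fin K.Units_one_closed] by blast
    have "trivial_quandle (fiber P f q)"
      using quandle_isomorphic_trivial_iff[OF iso fiber_quandle[OF D]] K.Alex_add_monoid_trivial
      by simp
    moreover have "card (carrier (fiber P f q)) = 3"
      using quandle_isomorphic_card[OF iso] by (simp add: Alex_def GF3_def)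
    ultimately show ?thesis using D by force
  qed
  show "\<exists>(P :: nat quandle) (Q :: nat quandle) f q (A :: nat monoid) \<sigma>.
      doubly_transitive P Q f \<and> q \<in> carrier Q \<and>
      comm_group A \<and> \<sigma> \<in> iso A A \<and> quandle_isomorphic (fiber P f q) (Alex A \<sigma>) \<and>
      connected_quandle (fiber P f q) \<and> \<not> trivial_quandle (fiber P f q)"
  proof -
    \<comment> \<open>Here \<open>2\<close> is \<open>-1\<close>, so the fiber is the dihedral
      quandle of order three.\<close>
    define \<sigma> where "\<sigma> = (\<lambda>y. 2 \<otimes>\<^bsub>GF3\<^esub> y)"
    have two: "2 \<in> Units GF3" "2 \<in> carrier GF3" "2 \<noteq> \<one>\<^bsub>GF3\<^esub>"
      unfolding K.mem_Units_iff by (simp_all add: GF3_def)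
    obtain P Q :: "nat quandle" and f q where D: "doubly_transitive P Q f" "q \<in> carrier Q"
      and iso: "quandle_isomorphic (fiber P f q) (Alex (add_monoid GF3) \<sigma>)"
      using K.Alex_fiber_exists[OF fin two(1)] unfolding \<sigma>_def by blast
    have conn: "connected_quandle (fiber P f q)"
      using iso fiber_quandle[OF D]
    proof (rule quandle_isomorphic_connectedI)
      show "carrier (Alex (add_monoid GF3) \<sigma>) \<noteq> {}" by (simp add: Alex_def GF3_def)
    qed (unfold \<sigma>_def, rule K.Alex_add_monoid_transitive[OF two(2,3)])
    have "\<not> trivial_quandle (Alex (add_monoid GF3) \<sigma>)"
      unfolding \<sigma>_def by (rule K.Alex_add_monoid_not_trivial[OF two(2,3)])
    then have "\<not> trivial_quandle (fiber P f q)"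
      using quandle_isomorphic_trivial_iff[OF iso fiber_quandle[OF D]] by simp
    moreover have "\<sigma> \<in> iso (add_monoid GF3) (add_monoid GF3)"
      unfolding \<sigma>_def by (rule K.mult_unit_iso_add_monoid[OF two(1)])
    ultimately show ?thesis
      using D iso conn K.a_comm_group by blast
  qed
qed

end
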